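(* Let $(X,T)$ be a topological dynamical system. Then $(X,T)$ is logarithmically mean equicontinuous if and only if it is mean equicontinuous.
   Context: A topological dynamical system is a pair $(X,T)$ where $(X,d)$ is a compact metric space and $T\colon X\to X$ is a continuous map (not necessarily invertible or surjective). Write $H_n=\sum_{k=1}^n \frac1k$. $(X,T)$ is mean equicontinuous if for every $\varepsilon>0$ there exists $\delta>0$ such that for all $x,y\in X$ with $d(x,y)<\delta$, $$\limsup_{n\to\infty}\frac1n\sum_{k=1}^n d(T^{k-1}x,T^{k-1}y)<\varepsilon.$$ $(X,T)$ is logarithmically mean equicontinuous if for every $\varepsilon>0$ there exists $\delta>0$ such that for all $x,y\in X$ with $d(x,y)<\delta$, $$\limsup_{n\to\infty}\frac1{H_n}\sum_{k=1}^n \frac1k\, d(T^{k-1}x,T^{k-1}y)<\varepsilon.$$ *)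

theory Defs
  imports "HOL-Analysis.Analysis"
begin

definition topological_dynamical_system :: "'a::metric_space set \<Rightarrow> ('a \<Rightarrow> 'a) \<Rightarrow> bool" where
  "topological_dynamical_system X T \<longleftrightarrow> compact X \<and> continuous_on X T \<and> T ` X \<subseteq> X"

(* The limsups are taken in the extended reals, where they always exist. The index n = 0
   (division by 0 or by harm 0 = 0) is irrelevant to them. *)

definition mean_equicontinuous :: "'a::metric_space set \<Rightarrow> ('a \<Rightarrow> 'a) \<Rightarrow> bool" where
  "mean_equicontinuous X T \<longleftrightarrow>
    (\<forall>\<epsilon>::real. \<epsilon> > 0 \<longrightarrow> (\<exists>\<delta>::real. \<delta> > 0 \<and>
      (\<forall>x\<in>X. \<forall>y\<in>X. dist x y < \<delta> \<longrightarrow>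
        limsup (\<lambda>n. ereal (1 / real n *
          (\<Sum>k=1..n. dist ((T ^^ (k - 1)) x) ((T ^^ (k - 1)) y)))) < ereal \<epsilon>)))"

definition log_mean_equicontinuous :: "'a::metric_space set \<Rightarrow> ('a \<Rightarrow> 'a) \<Rightarrow> bool" where
  "log_mean_equicontinuous X T \<longleftrightarrow>
    (\<forall>\<epsilon>::real. \<epsilon> > 0 \<longrightarrow> (\<exists>\<delta>::real. \<delta> > 0 \<and>
      (\<forall>x\<in>X. \<forall>y\<in>X. dist x y < \<delta> \<longrightarrow>
        limsup (\<lambda>n. ereal (1 / harm n *
          (\<Sum>k=1..n. 1 / real k * dist ((T ^^ (k - 1)) x) ((T ^^ (k - 1)) y)))) < ereal \<epsilon>)))"

end

theory Submission
  imports Defs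
begin

text \<open>
  Summation by parts writes logarithmic averages as weighted means of Cesaro averages, so mean
  equicontinuity passes to the logarithmic version, and a point whose Cesaro averages are all at
  least \<open>c\<close> also has logarithmic averages at least \<open>c\<close>.

  Conversely, under logarithmic mean equicontinuity the upper logarithmic average of \<open>d\<close> along
  orbits of pairs is an invariant, continuous pseudometric, so it is small on the whole orbit closure
  of a pair \<open>(x, y)\<close> with \<open>d(x, y)\<close> small. Hence every pair in that closure has
  some small Cesaro average, by compactness at a time bounded by a fixed \<open>N\<close>. Cutting
  the orbit of \<open>(x, y)\<close> into blocks of length at most \<open>N\<close> bounds its Cesaro averages.
\<close>

section \<open>Logarithmic sums: summation by parts and shifts\<close>

definition log_sum :: "(nat \<Rightarrow> real) \<Rightarrow> nat \<Rightarrow> real" where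
  "log_sum a n = (\<Sum>j<n. a j / real (Suc j))"

lemma log_sum_0 [simp]: "log_sum a 0 = 0"
  and log_sum_Suc: "log_sum a (Suc n) = log_sum a n + a n / real (Suc n)"
  by (simp_all add: log_sum_def)

lemma log_sum_const: "log_sum (\<lambda>_. c) n = c * harm n"
  by (induction n) (simp_all add: log_sum_Suc harm_Suc harm_expand(1) field_simps)

lemma log_sum_diff: "log_sum (\<lambda>j. a j - b j) n = log_sum a n - log_sum b n"
  by (simp add: log_sum_def diff_divide_distrib sum_subtractf)

lemma log_sum_add: "log_sum (\<lambda>j. a j + b j) n = log_sum a n + log_sum b n"
  by (simp add: log_sum_def add_divide_distrib sum.distrib)

lemma log_sum_mono: "(\<And>j. a j \<le> b j) \<Longrightarrow> log_sum a n \<le> log_sum b n"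
  by (auto simp: log_sum_def intro!: sum_mono divide_right_mono)

text \<open>Abel summation with \<open>1 / (k + 1) - 1 / (k + 2) = 1 / ((k + 1) * (k + 2))\<close>.
  The term at \<open>k\<close> is the Cesaro average of length \<open>k + 1\<close> with the
  positive weight \<open>1 / (k + 2)\<close>, so sign information on partial sums passes to
  \<open>log_sum\<close>.\<close>

lemma log_sum_by_parts:
  "log_sum a n = (\<Sum>j<n. a j) / real (Suc n)
     + (\<Sum>k<n. (\<Sum>j<Suc k. a j) / (real (Suc k) * real (Suc (Suc k))))"
proof (induction n)
  case (Suc n)
  have "s / x + s / (y * x) = s / y" if "x = y + 1" "y > 0" for s x y :: real
    using that by (simp add: divide_simps) (simp add: algebra_simps)
  from this[of "real (Suc (Suc n))" "real (Suc n)" "\<Sum>j<Suc n. a j"]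
  have "(\<Sum>j<Suc n. a j) / real (Suc (Suc n))
      + (\<Sum>j<Suc n. a j) / (real (Suc n) * real (Suc (Suc n))) = (\<Sum>j<Suc n. a j) / real (Suc n)"
    by simp
  also have "\<dots> = (\<Sum>j<n. a j) / real (Suc n) + a n / real (Suc n)"
    by (simp add: add_divide_distrib)
  finally show ?case
    by (simp only: log_sum_Suc Suc.IH sum.lessThan_Suc[of _ n])
qed simp

text \<open>All partial sums of \<open>a j - c\<close> are nonnegative, hence so is every term of
  the summation by parts.\<close>

lemma log_sum_ge:
  assumes "\<And>k. c * real k \<le> (\<Sum>j<k. a j)"
  shows "c * harm n \<le> log_sum a n"
proof -
  have nonneg: "0 \<le> (\<Sum>j<k. a j - c)" for k
    using assms[of k] by (simp add: sum_subtractf mult.commute)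
  have "0 \<le> log_sum (\<lambda>j. a j - c) n"
    unfolding log_sum_by_parts
    by (rule add_nonneg_nonneg[OF divide_nonneg_nonneg[OF nonneg]
          sum_nonneg[OF divide_nonneg_nonneg[OF nonneg]]]) auto
  then show ?thesis
    by (simp add: log_sum_diff log_sum_const)
qed

text \<open>After subtracting \<open>c\<close>, the terms of the summation by parts are nonpositive
  from some index \<open>N\<close> on. The finitely many earlier ones make up \<open>C\<close>,
  which is negligible against \<open>harm n\<close>.\<close>

lemma log_sum_le:
  assumes "eventually (\<lambda>k. (\<Sum>j<k. a j) \<le> c * real k) sequentially"
  shows "\<exists>C. eventually (\<lambda>n. log_sum a n \<le> c * harm n + C) sequentially"
proof -
  define S where "S k = (\<Sum>j<k. a j - c)" for k
  define g where "g k = S (Suc k) / (real (Suc k) * real (Suc (Suc k)))" for k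
  obtain N where N: "(\<Sum>j<k. a j) \<le> c * real k" if "k \<ge> N" for k
    using assms by (auto simp: eventually_sequentially)
  have S: "S k \<le> 0" if "k \<ge> N" for k
    using N[OF that] by (simp add: S_def sum_subtractf mult.commute)
  have "log_sum a n \<le> c * harm n + (\<Sum>k<N. g k)" if "n \<ge> N" for n
  proof -
    have "(\<Sum>k<n. g k) = (\<Sum>k<N. g k) + (\<Sum>k=N..<n. g k)"
      using sum.atLeastLessThan_concat[of 0 N n g] that by (simp add: lessThan_atLeast0)
    moreover have "(\<Sum>k=N..<n. g k) \<le> 0"
      by (intro sum_nonpos) (auto simp: g_def intro!: divide_nonpos_nonneg S)
    moreover have "S n / real (Suc n) \<le> 0"
      by (intro divide_nonpos_nonneg S that) auto
    moreover have "log_sum (\<lambda>j. a j - c) n = S n / real (Suc n) + (\<Sum>k<n. g k)"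
      unfolding log_sum_by_parts S_def g_def ..
    ultimately show ?thesis
      by (simp add: log_sum_diff log_sum_const)
  qed
  then show ?thesis
    by (auto simp: eventually_sequentially)
qed

lemma log_sum_shift_Suc_le:
  assumes "\<And>j. 0 \<le> a j" "\<And>j. a j \<le> M"
  shows "log_sum (\<lambda>j. a (Suc j)) n \<le> log_sum a n + 2 * M"
proof -
  \<comment> \<open>The error \<open>2M\<close> is one boundary term plus \<open>M\<close> times the telescoping sum of
    \<open>1 / ((j + 1) (j + 2))\<close>.\<close>
  have "log_sum (\<lambda>j. a (Suc j)) n \<le> log_sum a (Suc n) + M * (1 - 1 / real (Suc n))"
  proof (induction n)
    case 0
    then show ?case using assms(1)[of 0] by (simp add: log_sum_Suc)
  next
    case (Suc n)
    have "a (Suc n) / real (Suc n) - a (Suc n) / real (Suc (Suc n))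
        = a (Suc n) * (1 / real (Suc n) - 1 / real (Suc (Suc n)))"
      by (simp add: algebra_simps)
    also have "\<dots> \<le> M * (1 / real (Suc n) - 1 / real (Suc (Suc n)))"
      by (intro mult_right_mono assms) (simp add: frac_le)
    finally show ?case
      using Suc.IH
      by (simp only: log_sum_Suc[of _ "Suc n"] log_sum_Suc[of "\<lambda>j. a (Suc j)" n] right_diff_distrib)
  qed
  moreover have "a n / real (Suc n) \<le> M"
  proof -
    have "a n / real (Suc n) \<le> a n / 1"
      by (intro divide_left_mono assms) auto
    then show ?thesis using assms(2)[of n] by linarith
  qed
  moreover have "M * (1 - 1 / real (Suc n)) \<le> M * 1"
    using order_trans[OF assms] by (intro mult_left_mono) auto
  ultimately show ?thesis
    by (simp only: log_sum_Suc)
qed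

text \<open>The error does not grow with \<open>n\<close>, so it disappears after division by
  \<open>harm n\<close>: moving a pair along its orbit does not increase its upper logarithmic
  average.\<close>

lemma log_sum_shift_le:
  assumes "\<And>j. 0 \<le> a j" "\<And>j. a j \<le> M"
  shows "log_sum (\<lambda>j. a (j + p)) n \<le> log_sum a n + 2 * M * real p"
proof (induction p)
  case (Suc p)
  have "log_sum (\<lambda>j. a (Suc j + p)) n \<le> log_sum (\<lambda>j. a (j + p)) n + 2 * M"
    using log_sum_shift_Suc_le[of "\<lambda>j. a (j + p)"] assms by simp
  with Suc.IH show ?case by (simp add: algebra_simps)
qed simp

text \<open>Greedy cutting: remove a good block from the front and continue at its end, which is why
  \<open>p\<close> is arbitrary in the induction; \<open>m \<ge> 1\<close> ensures progress. The
  leftover piece has fewer than \<open>N\<close> terms, each at most \<open>M\<close>.\<close>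

lemma sum_le_of_blocks:
  fixes a :: "nat \<Rightarrow> real"
  assumes "\<And>j. 0 \<le> a j" "\<And>j. a j \<le> M" and "0 \<le> c"
    and blocks: "\<And>p. \<exists>m\<in>{1..N}. (\<Sum>j<m. a (j + p)) \<le> c * real m"
  shows "(\<Sum>j<n. a (j + p)) \<le> c * real n + M * real N"
proof (induction n arbitrary: p rule: less_induct)
  case (less n)
  have M: "0 \<le> M" using order_trans[OF assms(1,2)] .
  obtain m where m: "1 \<le> m" "m \<le> N" "(\<Sum>j<m. a (j + p)) \<le> c * real m"
    using blocks[of p] by auto
  show ?case
  proof (cases "m \<le> n")
    case True
    have "(\<Sum>j<m + k. a (j + p)) = (\<Sum>j<m. a (j + p)) + (\<Sum>j<k. a (j + (m + p)))" for k
      by (induction k) (simp_all add: add_ac)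
    from this[of "n - m"]
    have "(\<Sum>j<n. a (j + p)) = (\<Sum>j<m. a (j + p)) + (\<Sum>j<n - m. a (j + (m + p)))"
      using True by simp
    also have "\<dots> \<le> c * real m + (c * real (n - m) + M * real N)"
      using m True by (intro add_mono less.IH) auto
    also have "\<dots> = c * real n + M * real N"
      using True by (simp add: of_nat_diff algebra_simps)
    finally show ?thesis .
  next
    case False
    have "(\<Sum>j<n. a (j + p)) \<le> real n * M"
      using sum_bounded_above[of "{..<n}" "\<lambda>j. a (j + p)" M] assms(2) by simp
    also have "\<dots> \<le> real N * M"
      using False m M by (intro mult_right_mono) auto
    finally show ?thesis
      using \<open>0 \<le> c\<close> by (simp add: mult.commute add_increasing)
  qed
qed

section \<open>Translation between limsups of averages and eventual bounds on sums\<close>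

lemma eventually_less_of_limsup_average:
  fixes s w :: "nat \<Rightarrow> real"
  assumes "limsup (\<lambda>n. ereal (1 / w n * s n)) < ereal \<epsilon>" and w: "filterlim w at_top sequentially"
  shows "eventually (\<lambda>n. s n < \<epsilon> * w n) sequentially"
proof -
  have "eventually (\<lambda>n. ereal (1 / w n * s n) < ereal \<epsilon>) sequentially"
    using assms(1) by (rule Limsup_lessD)
  moreover have "eventually (\<lambda>n. 0 < w n) sequentially"
    using w by (simp add: filterlim_at_top_dense)
  ultimately show ?thesis
    by eventually_elim (simp add: field_simps)
qed

lemma limsup_average_less:
  fixes s w :: "nat \<Rightarrow> real"
  assumes ev: "eventually (\<lambda>n. s n \<le> c * w n + C) sequentially"
    and w: "filterlim w at_top sequentially" and "c < \<epsilon>"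
  shows "limsup (\<lambda>n. ereal (1 / w n * s n)) < ereal \<epsilon>"
proof -
  \<comment> \<open>The gap between \<open>c\<close> and \<open>b\<close> absorbs \<open>C\<close>
    once \<open>w n\<close> exceeds \<open>C / (b - c)\<close>; the gap between \<open>b\<close> and
    \<open>\<epsilon>\<close> keeps the inequality strict in the limsup.\<close>
  obtain b where b: "c < b" "b < \<epsilon>" using \<open>c < \<epsilon>\<close> dense by blast
  have "eventually (\<lambda>n. max 0 (C / (b - c)) < w n) sequentially"
    using w unfolding filterlim_at_top_dense by blast
  then have "eventually (\<lambda>n. ereal (1 / w n * s n) \<le> ereal b) sequentially"
    using ev
  proof eventually_elim
    case (elim n)
    then have "C \<le> (b - c) * w n" using b by (simp add: field_simps)
    with elim show ?case by (simp add: field_simps)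
  qed
  then have "limsup (\<lambda>n. ereal (1 / w n * s n)) \<le> ereal b"
    by (rule Limsup_bounded)
  also have "\<dots> < ereal \<epsilon>" using b by simp
  finally show ?thesis .
qed

section \<open>Distances along orbits, and the passage from Cesaro to logarithmic averages\<close>

definition orbit_dist :: "('a::metric_space \<Rightarrow> 'a) \<Rightarrow> 'a \<Rightarrow> 'a \<Rightarrow> nat \<Rightarrow> real" where
  "orbit_dist T x y j = dist ((T ^^ j) x) ((T ^^ j) y)"

lemma orbit_dist_nonneg: "0 \<le> orbit_dist T x y j"
  by (simp add: orbit_dist_def)

lemma orbit_dist_funpow: "orbit_dist T ((T ^^ p) x) ((T ^^ p) y) j = orbit_dist T x y (j + p)"
  by (simp add: orbit_dist_def funpow_add)

lemma log_sum_orbit_dist_triangle: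
  "log_sum (orbit_dist T x z) n \<le> log_sum (orbit_dist T x y) n + log_sum (orbit_dist T y z) n"
  unfolding log_sum_add[symmetric] by (intro log_sum_mono) (simp add: orbit_dist_def dist_triangle)

text \<open>The substitution \<open>k = j + 1\<close> removes the truncated subtraction
  \<open>k - 1\<close>.\<close>

lemma mean_equicontinuous_iff:
  "mean_equicontinuous X T \<longleftrightarrow> (\<forall>\<epsilon>>0. \<exists>\<delta>>0. \<forall>x\<in>X. \<forall>y\<in>X. dist x y < \<delta> \<longrightarrow>
     limsup (\<lambda>n. ereal (1 / real n * (\<Sum>j<n. orbit_dist T x y j))) < ereal \<epsilon>)"
proof -
  have "(\<Sum>k=1..n. dist ((T ^^ (k - 1)) x) ((T ^^ (k - 1)) y)) = (\<Sum>j<n. orbit_dist T x y j)" for n x y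
    by (induction n) (simp_all add: orbit_dist_def)
  then show ?thesis by (simp add: mean_equicontinuous_def)
qed

lemma log_mean_equicontinuous_iff:
  "log_mean_equicontinuous X T \<longleftrightarrow> (\<forall>\<epsilon>>0. \<exists>\<delta>>0. \<forall>x\<in>X. \<forall>y\<in>X. dist x y < \<delta> \<longrightarrow>
     limsup (\<lambda>n. ereal (1 / harm n * log_sum (orbit_dist T x y) n)) < ereal \<epsilon>)"
proof -
  have "(\<Sum>k=1..n. 1 / real k * dist ((T ^^ (k - 1)) x) ((T ^^ (k - 1)) y))
      = log_sum (orbit_dist T x y) n" for n x y
    by (induction n) (simp_all add: orbit_dist_def log_sum_Suc)
  then show ?thesis by (simp add: log_mean_equicontinuous_def)
qed

lemma mean_equicontinuous_imp_log:
  assumes "mean_equicontinuous X T"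
  shows "log_mean_equicontinuous X T"
  unfolding log_mean_equicontinuous_iff
proof (intro allI impI)
  fix \<epsilon> :: real assume "\<epsilon> > 0"
  \<comment> \<open>Half of \<open>\<epsilon>\<close> leaves room for the additive constant that
    \<open>log_sum_le\<close> produces.\<close>
  then obtain \<delta> where "\<delta> > 0" and \<delta>: "\<And>x y. x \<in> X \<Longrightarrow> y \<in> X \<Longrightarrow> dist x y < \<delta> \<Longrightarrow>
      limsup (\<lambda>n. ereal (1 / real n * (\<Sum>j<n. orbit_dist T x y j))) < ereal (\<epsilon> / 2)"
    using assms unfolding mean_equicontinuous_iff by (metis half_gt_zero)
  have "limsup (\<lambda>n. ereal (1 / harm n * log_sum (orbit_dist T x y) n)) < ereal \<epsilon>"
    if "x \<in> X" "y \<in> X" "dist x y < \<delta>" for x y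
  proof -
    have "eventually (\<lambda>n. (\<Sum>j<n. orbit_dist T x y j) < \<epsilon> / 2 * real n) sequentially"
      using eventually_less_of_limsup_average[OF \<delta>[OF that] filterlim_real_sequentially] .
    then have "eventually (\<lambda>n. (\<Sum>j<n. orbit_dist T x y j) \<le> \<epsilon> / 2 * real n) sequentially"
      by (rule eventually_mono) simp
    then obtain C where "eventually (\<lambda>n. log_sum (orbit_dist T x y) n \<le> \<epsilon> / 2 * harm n + C) sequentially"
      using log_sum_le by blast
    then show ?thesis
      using harm_at_top by (rule limsup_average_less) (use \<open>\<epsilon> > 0\<close> in simp)
  qed
  with \<open>\<delta> > 0\<close> show "\<exists>\<delta>>0. \<forall>x\<in>X. \<forall>y\<in>X. dist x y < \<delta> \<longrightarrow>
      limsup (\<lambda>n. ereal (1 / harm n * log_sum (orbit_dist T x y) n)) < ereal \<epsilon>"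
    by blast
qed

section \<open>Compactness, and the passage from logarithmic to Cesaro averages\<close>

context
  fixes X :: "'a::metric_space set" and T :: "'a \<Rightarrow> 'a"
  assumes tds: "topological_dynamical_system X T"
begin

lemma funpow_in: "x \<in> X \<Longrightarrow> (T ^^ j) x \<in> X"
  using tds by (induction j) (auto simp: topological_dynamical_system_def)

lemma continuous_on_funpow: "continuous_on X (T ^^ j)"
proof (induction j)
  case (Suc j)
  have "continuous_on ((T ^^ j) ` X) T"
    using tds funpow_in by (auto simp: topological_dynamical_system_def intro: continuous_on_subset)
  from continuous_on_compose[OF Suc.IH this] show ?case by (simp add: comp_def)
qed simp

lemma orbit_dist_le_diameter:
  assumes "x \<in> X" "y \<in> X"
  shows "orbit_dist T x y j \<le> diameter X"
  using tds assms funpow_in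
  by (auto simp: orbit_dist_def topological_dynamical_system_def compact_imp_bounded
      intro!: diameter_bounded_bound)

lemma tendsto_orbit_dist:
  assumes "\<And>i. u i \<in> X" "\<And>i. v i \<in> X" and "u \<longlonglongrightarrow> x" "v \<longlonglongrightarrow> y" and "x \<in> X" "y \<in> X"
  shows "(\<lambda>i. orbit_dist T (u i) (v i) j) \<longlonglongrightarrow> orbit_dist T x y j"
  unfolding orbit_dist_def
  using assms by (intro tendsto_dist continuous_on_tendsto_compose[OF continuous_on_funpow]) auto

text \<open>
  If the conclusion fails, some limit \<open>(u, v)\<close> of the orbit of \<open>(x, y)\<close> has all Cesaro sums at least
  \<open>4 \<eta> n\<close>, hence logarithmic averages at least \<open>4 \<eta>\<close>. But going from \<open>u\<close> to \<open>v\<close> through a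
  nearby orbit point costs less than \<open>\<eta>\<close> for each of the two short jumps and \<open>2 \<eta>\<close> in between.
\<close>

lemma bounded_return_to_small_average:
  assumes "\<eta> > 0" "\<delta> > 0"
    and small: "\<And>x y. x \<in> X \<Longrightarrow> y \<in> X \<Longrightarrow> dist x y < \<delta> \<Longrightarrow>
      eventually (\<lambda>n. log_sum (orbit_dist T x y) n < \<eta> * harm n) sequentially"
    and xy: "x \<in> X" "y \<in> X" "dist x y < \<delta>"
  shows "\<exists>N. \<forall>p. \<exists>m\<in>{1..N}. (\<Sum>j<m. orbit_dist T x y (j + p)) \<le> 4 * \<eta> * real m"
proof (rule ccontr)
  assume "\<not> ?thesis"
  then have "\<forall>N. \<exists>p. \<forall>m\<in>{1..N}. 4 * \<eta> * real m < (\<Sum>j<m. orbit_dist T x y (j + p))"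
    by (simp add: not_le)
  \<comment> \<open>From time \<open>p N\<close> on, every window of length at most \<open>N\<close>
    has a large average.\<close>
  then obtain p where p: "4 * \<eta> * real m < (\<Sum>j<m. orbit_dist T x y (j + p N))"
    if "m \<in> {1..N}" for m N
    by metis
  define z where "z N = ((T ^^ p N) x, (T ^^ p N) y)" for N
  have z: "z N \<in> X \<times> X" for N using xy by (simp add: z_def funpow_in)
  \<comment> \<open>Compactness of the product gives one subsequence along which both coordinates
    converge.\<close>
  have "seq_compact (X \<times> X)"
    using tds by (simp add: topological_dynamical_system_def compact_Times compact_imp_seq_compact)
  then obtain l r where "l \<in> X \<times> X" and r: "strict_mono r" and lim: "(z \<circ> r) \<longlonglongrightarrow> l"
    using z seq_compactE by metis
  obtain u v where l: "l = (u, v)" by (cases l)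
  then have uv: "u \<in> X" "v \<in> X" using \<open>l \<in> X \<times> X\<close> by auto
  have xlim: "(\<lambda>i. (T ^^ p (r i)) x) \<longlonglongrightarrow> u" and ylim: "(\<lambda>i. (T ^^ p (r i)) y) \<longlonglongrightarrow> v"
    using tendsto_fst[OF lim] tendsto_snd[OF lim] by (simp_all add: z_def l comp_def)
  have "4 * \<eta> * real m \<le> (\<Sum>j<m. orbit_dist T u v j)" for m
  proof (rule tendsto_lowerbound)
    show "(\<lambda>i. \<Sum>j<m. orbit_dist T ((T ^^ p (r i)) x) ((T ^^ p (r i)) y) j)
        \<longlonglongrightarrow> (\<Sum>j<m. orbit_dist T u v j)"
      using xy uv xlim ylim by (intro tendsto_sum tendsto_orbit_dist funpow_in)
    \<comment> \<open>A fixed length \<open>m\<close> is eventually covered by the choice of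
      \<open>p\<close>, because \<open>m \<le> i \<le> r i\<close>.\<close>
    have "4 * \<eta> * real m \<le> (\<Sum>j<m. orbit_dist T x y (j + p (r i)))" if "i \<ge> m" for i
    proof (cases "m = 0")
      case False
      with that seq_suble[OF r, of i] show ?thesis by (intro less_imp_le p) auto
    qed simp
    then show "eventually (\<lambda>i. 4 * \<eta> * real m
        \<le> (\<Sum>j<m. orbit_dist T ((T ^^ p (r i)) x) ((T ^^ p (r i)) y) j)) sequentially"
      by (auto simp: orbit_dist_funpow eventually_sequentially)
  qed simp
  then have lower: "4 * \<eta> * harm n \<le> log_sum (orbit_dist T u v) n" for n
    by (rule log_sum_ge)
  have "eventually (\<lambda>i. dist ((T ^^ p (r i)) x) u < \<delta> \<and> dist ((T ^^ p (r i)) y) v < \<delta>) sequentially"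
    using tendstoD[OF xlim \<open>\<delta> > 0\<close>] tendstoD[OF ylim \<open>\<delta> > 0\<close>] by (rule eventually_conj)
  then obtain i where i: "dist ((T ^^ p (r i)) x) u < \<delta>" "dist ((T ^^ p (r i)) y) v < \<delta>"
    using eventually_happens'[OF sequentially_bot] by blast
  define q where "q = p (r i)"
  have shift: "log_sum (orbit_dist T ((T ^^ q) x) ((T ^^ q) y)) n
      \<le> log_sum (orbit_dist T x y) n + 2 * diameter X * real q" for n
    unfolding orbit_dist_funpow[abs_def]
    by (rule log_sum_shift_le[OF orbit_dist_nonneg orbit_dist_le_diameter[OF xy(1,2)]])
  have "eventually (\<lambda>n. log_sum (orbit_dist T u ((T ^^ q) x)) n < \<eta> * harm n) sequentially"
    using i xy uv by (intro small funpow_in) (auto simp: q_def dist_commute)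
  moreover have "eventually (\<lambda>n. log_sum (orbit_dist T ((T ^^ q) y) v) n < \<eta> * harm n) sequentially"
    using i xy uv by (intro small funpow_in) (auto simp: q_def)
  moreover note small[OF xy]
  \<comment> \<open>For large \<open>n\<close> the shift error is at most
    \<open>\<eta> * harm n\<close>. Together with the two jumps and the original pair this makes
    four such amounts, three of them strict, against the lower bound
    \<open>4 * \<eta> * harm n\<close>.\<close>
  moreover have "eventually (\<lambda>n. 2 * diameter X * real q / \<eta> \<le> harm n) sequentially"
    using harm_at_top by (simp add: filterlim_at_top)
  ultimately have "eventually (\<lambda>n::nat. False) sequentially"
  proof eventually_elim
    case (elim n)
    have "log_sum (orbit_dist T u v) n \<le> log_sum (orbit_dist T u ((T ^^ q) x)) n
        + (log_sum (orbit_dist T ((T ^^ q) x) ((T ^^ q) y)) n + log_sum (orbit_dist T ((T ^^ q) y) v) n)"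
      by (meson log_sum_orbit_dist_triangle add_left_mono order_trans)
    moreover have "2 * diameter X * real q \<le> \<eta> * harm n"
      using elim(4) \<open>\<eta> > 0\<close> by (simp add: pos_divide_le_eq mult.commute)
    ultimately show ?case
      using elim lower[of n] shift[of n] by linarith
  qed
  then show False by simp
qed

lemma log_mean_equicontinuous_imp_mean:
  assumes "log_mean_equicontinuous X T"
  shows "mean_equicontinuous X T"
  unfolding mean_equicontinuous_iff
proof (intro allI impI)
  fix \<epsilon> :: real assume "\<epsilon> > 0"
  \<comment> \<open>The Cesaro bound will be \<open>4 * \<eta>\<close>, and dividing by 5 puts it
    strictly below \<open>\<epsilon>\<close>.\<close>
  define \<eta> where "\<eta> = \<epsilon> / 5"
  have "\<eta> > 0" using \<open>\<epsilon> > 0\<close> by (simp add: \<eta>_def)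
  then obtain \<delta> where "\<delta> > 0" and \<delta>: "\<And>x y. x \<in> X \<Longrightarrow> y \<in> X \<Longrightarrow> dist x y < \<delta> \<Longrightarrow>
      limsup (\<lambda>n. ereal (1 / harm n * log_sum (orbit_dist T x y) n)) < ereal \<eta>"
    using assms unfolding log_mean_equicontinuous_iff by metis
  have small: "eventually (\<lambda>n. log_sum (orbit_dist T x y) n < \<eta> * harm n) sequentially"
    if "x \<in> X" "y \<in> X" "dist x y < \<delta>" for x y
    using eventually_less_of_limsup_average[OF \<delta>[OF that] harm_at_top] .
  have "limsup (\<lambda>n. ereal (1 / real n * (\<Sum>j<n. orbit_dist T x y j))) < ereal \<epsilon>"
    if xy: "x \<in> X" "y \<in> X" "dist x y < \<delta>" for x y
  proof -
    \<comment> \<open>\<open>N\<close> may depend on the pair: it enters only an additive constant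
      that the limsup ignores, while \<open>\<delta>\<close> is uniform.\<close>
    obtain N where N: "\<And>p. \<exists>m\<in>{1..N}. (\<Sum>j<m. orbit_dist T x y (j + p)) \<le> 4 * \<eta> * real m"
      using bounded_return_to_small_average[OF \<open>\<eta> > 0\<close> \<open>\<delta> > 0\<close> small xy] by blast
    have "(\<Sum>j<n. orbit_dist T x y j) \<le> 4 * \<eta> * real n + diameter X * real N" for n
      using sum_le_of_blocks[OF orbit_dist_nonneg orbit_dist_le_diameter[OF xy(1,2)] _ N, where p = 0]
        \<open>\<eta> > 0\<close> by simp
    then have "eventually (\<lambda>n. (\<Sum>j<n. orbit_dist T x y j)
        \<le> 4 * \<eta> * real n + diameter X * real N) sequentially"
      by simp
    then show ?thesis
      using filterlim_real_sequentially
      by (rule limsup_average_less) (use \<open>\<epsilon> > 0\<close> in \<open>simp add: \<eta>_def\<close>)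
  qed
  with \<open>\<delta> > 0\<close> show "\<exists>\<delta>>0. \<forall>x\<in>X. \<forall>y\<in>X. dist x y < \<delta> \<longrightarrow>
      limsup (\<lambda>n. ereal (1 / real n * (\<Sum>j<n. orbit_dist T x y j))) < ereal \<epsilon>"
    by blast
qed

end

theorem theorem1p1:
  fixes X :: "'a::metric_space set" and T :: "'a \<Rightarrow> 'a"
  assumes "topological_dynamical_system X T"
  shows "log_mean_equicontinuous X T \<longleftrightarrow> mean_equicontinuous X T"
  using log_mean_equicontinuous_imp_mean[OF assms] mean_equicontinuous_imp_log by blast

end
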